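(* Let $N$ be a set of positive integers. The class of bimonoidal subreducts of commutative involutive residuated pomonoids satisfying $x\leq x^{n}$ for all $n\in N$ is the class of commutative bimonoids axiomatized by the inequalities $x\leq x^{n}$ and $nx\leq x$ for $n\in N$.
   Context: A commutative bimonoid $\langle A,\leq,\cdot,1,+,0\rangle$ is a poset with two commutative monoid operations $\cdot$ (unit $1$) and $+$ (unit $0$), both order preserving, satisfying $x\cdot(y+z)\leq(x\cdot y)+z$. Here $x^{n}$ is the $n$-fold product and $nx$ the $n$-fold sum of $x$. A commutative involutive residuated pomonoid $\langle B,\leq,\cdot,1,\rightarrow,0\rangle$ is a commutative pomonoid with an operation $\rightarrow$ satisfying $x\cdot y\leq z\iff y\leq x\rightarrow z$ and a constant $0$ with $(x\rightarrow 0)\rightarrow 0=x$; setting $\overline{x}=x\rightarrow 0$ and $x+y:=\overline{\overline{x}\cdot\overline{y}}$, its bimonoid reduct is $\langle B,\leq,\cdot,1,+,0\rangle$. A bimonoidal subreduct of $\mathbf{B}$ is a bimonoid that embeds (order embedding preserving $\cdot,1,+,0$) into this reduct. *)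

theory Defs
  imports "HOL-Algebra.Group"
begin

record 'a pomonoid = "'a monoid" +
  leq :: "'a \<Rightarrow> 'a \<Rightarrow> bool"  (infixl \<open>\<preceq>\<index>\<close> 50)

locale comm_pomonoid = comm_monoid P for P (structure) +
  assumes leq_refl: "x \<in> carrier P \<Longrightarrow> x \<preceq> x"
    and leq_antisym:
      "\<lbrakk>x \<in> carrier P; y \<in> carrier P; x \<preceq> y; y \<preceq> x\<rbrakk> \<Longrightarrow> x = y"
    and leq_trans:
      "\<lbrakk>x \<in> carrier P; y \<in> carrier P; z \<in> carrier P; x \<preceq> y; y \<preceq> z\<rbrakk> \<Longrightarrow> x \<preceq> z"
    and mult_isotone:
      "\<lbrakk>x \<in> carrier P; y \<in> carrier P; u \<in> carrier P; v \<in> carrier P; x \<preceq> y; u \<preceq> v\<rbrakk>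
        \<Longrightarrow> x \<otimes> u \<preceq> y \<otimes> v"

record 'a bimonoid = "'a pomonoid" +
  bsum :: "'a \<Rightarrow> 'a \<Rightarrow> 'a"  (infixl \<open>\<oplus>\<index>\<close> 65)
  bzero :: 'a  (\<open>\<zero>\<index>\<close>)

text \<open>The multiple \<open>n x\<close> is the power \<open>x [^] n\<close> in this pomonoid.\<close>

definition sum_pomonoid :: "('a, 'm) bimonoid_scheme \<Rightarrow> 'a pomonoid" where
  "sum_pomonoid A = \<lparr>carrier = carrier A, monoid.mult = bsum A, one = bzero A, leq = leq A\<rparr>"

locale comm_bimonoid = comm_pomonoid A + sum: comm_pomonoid "sum_pomonoid A"
  for A (structure) +
  assumes hemidistrib:
    "\<lbrakk>x \<in> carrier A; y \<in> carrier A; z \<in> carrier A\<rbrakk> \<Longrightarrow> x \<otimes> (y \<oplus> z) \<preceq> (x \<otimes> y) \<oplus> z"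

record 'a irpomonoid = "'a pomonoid" +
  resid :: "'a \<Rightarrow> 'a \<Rightarrow> 'a"  (infixr \<open>\<leadsto>\<index>\<close> 60)
  falsum :: 'a  (\<open>\<ff>\<index>\<close>)

locale comm_inv_res_pomonoid = comm_pomonoid B for B (structure) +
  assumes resid_closed:
      "\<lbrakk>x \<in> carrier B; y \<in> carrier B\<rbrakk> \<Longrightarrow> x \<leadsto> y \<in> carrier B"
    and falsum_closed: "\<ff> \<in> carrier B"
    and residuation:
      "\<lbrakk>x \<in> carrier B; y \<in> carrier B; z \<in> carrier B\<rbrakk>
        \<Longrightarrow> x \<otimes> y \<preceq> z \<longleftrightarrow> y \<preceq> x \<leadsto> z"
    and involution: "x \<in> carrier B \<Longrightarrow> (x \<leadsto> \<ff>) \<leadsto> \<ff> = x"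

definition complement :: "('a, 'm) irpomonoid_scheme \<Rightarrow> 'a \<Rightarrow> 'a" where
  "complement B x = resid B x (falsum B)"

definition bimonoid_reduct :: "('a, 'm) irpomonoid_scheme \<Rightarrow> 'a bimonoid" where
  "bimonoid_reduct B =
    \<lparr>carrier = carrier B, monoid.mult = monoid.mult B, one = one B, leq = leq B,
     bsum = (\<lambda>x y. complement B (monoid.mult B (complement B x) (complement B y))),
     bzero = falsum B\<rparr>"

definition bimonoid_embedding ::
  "('a, 'm) bimonoid_scheme \<Rightarrow> ('b, 'n) bimonoid_scheme \<Rightarrow> ('a \<Rightarrow> 'b) \<Rightarrow> bool" where
  "bimonoid_embedding A C h \<longleftrightarrow>
     h \<in> carrier A \<rightarrow> carrier C \<and>
     (\<forall>x\<in>carrier A. \<forall>y\<in>carrier A. x \<preceq>\<^bsub>A\<^esub> y \<longleftrightarrow> h x \<preceq>\<^bsub>C\<^esub> h y) \<and>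
     (\<forall>x\<in>carrier A. \<forall>y\<in>carrier A. h (x \<otimes>\<^bsub>A\<^esub> y) = h x \<otimes>\<^bsub>C\<^esub> h y) \<and>
     h \<one>\<^bsub>A\<^esub> = \<one>\<^bsub>C\<^esub> \<and>
     (\<forall>x\<in>carrier A. \<forall>y\<in>carrier A. h (x \<oplus>\<^bsub>A\<^esub> y) = h x \<oplus>\<^bsub>C\<^esub> h y) \<and>
     h \<zero>\<^bsub>A\<^esub> = \<zero>\<^bsub>C\<^esub>"

definition bimonoidal_subreduct ::
  "('a, 'm) bimonoid_scheme \<Rightarrow> ('b, 'n) irpomonoid_scheme \<Rightarrow> bool" where
  "bimonoidal_subreduct A B \<longleftrightarrow>
     comm_bimonoid A \<and> (\<exists>h. bimonoid_embedding A (bimonoid_reduct B) h)"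

definition mult_expansive :: "nat set \<Rightarrow> ('a, 'm) pomonoid_scheme \<Rightarrow> bool" where
  "mult_expansive N P \<longleftrightarrow> (\<forall>n\<in>N. \<forall>x\<in>carrier P. x \<preceq>\<^bsub>P\<^esub> x [^]\<^bsub>P\<^esub> n)"

definition sum_contractive :: "nat set \<Rightarrow> ('a, 'm) bimonoid_scheme \<Rightarrow> bool" where
  "sum_contractive N A \<longleftrightarrow>
     (\<forall>n\<in>N. \<forall>x\<in>carrier A. x [^]\<^bsub>sum_pomonoid A\<^esub> n \<preceq>\<^bsub>A\<^esub> x)"

text \<open>Classes of bimonoids are represented by their members with carrier in a type \<open>'a\<close>.
  HOL cannot quantify existentially over types, so the type \<open>'b\<close> in which the ambient
  residuated pomonoid lives is a parameter.\<close>

definition subreduct_class :: "'b itself \<Rightarrow> nat set \<Rightarrow> 'a bimonoid set" where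
  "subreduct_class _ N =
     {A. \<exists>B :: 'b irpomonoid.
           comm_inv_res_pomonoid B \<and> mult_expansive N B \<and> bimonoidal_subreduct A B}"

definition axiomatized_class :: "nat set \<Rightarrow> 'a bimonoid set" where
  "axiomatized_class N = {A. comm_bimonoid A \<and> mult_expansive N A \<and> sum_contractive N A}"

end

theory Submission
  imports Defs "HOL-Algebra.Coset"
begin

text \<open>
  Given a commutative bimonoid \<open>A\<close>, read a pair \<open>(a, b)\<close> as the formal product of \<open>a\<close> with the
  complement of \<open>b\<close>. Such pairs form a commutative monoid, the product of the multiplicative and
  the additive monoid of \<open>A\<close>, with the pole \<open>D = {(a, b). a \<le> b}\<close>. The sets of pairs that are closed
  under double orthogonality with respect to \<open>D\<close> form a commutative involutive residuated
  pomonoid, as in the phase semantics of linear logic. Hemidistributivity is exactly what is needed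
  for \<open>{(a, 0)}\<close> and \<open>{(1, a)}\<close> to have closures that are orthogonals of each other, which makes
  \<open>a \<mapsto> {(a, 0)}\<^sup>\<bottom>\<^sup>\<bottom>\<close> an embedding. The inequality \<open>x \<le> x\<^sup>n\<close> for closed sets only needs that \<open>x\<^sup>n y \<in> D\<close>
  implies \<open>x y \<in> D\<close> for pairs, and there it follows from \<open>a \<le> a\<^sup>n\<close> and \<open>n b \<le> b\<close>.
\<close>

section \<open>Complements in involutive residuated pomonoids\<close>

context comm_inv_res_pomonoid
begin

lemma complement_closed: "x \<in> carrier B \<Longrightarrow> complement B x \<in> carrier B"
  by (simp add: complement_def resid_closed falsum_closed)

lemma complement_complement: "x \<in> carrier B \<Longrightarrow> complement B (complement B x) = x"
  by (simp add: complement_def involution)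

text \<open>Residuation turns reflexivity at \<open>complement B y\<close> into
  \<open>y \<otimes> complement B y \<preceq> \<ff>\<close>, and replacing \<open>y\<close> by the
  smaller \<open>x\<close> keeps the product below \<open>\<ff>\<close>.\<close>

lemma complement_antitone:
  assumes "x \<in> carrier B" "y \<in> carrier B" "x \<preceq> y"
  shows "complement B y \<preceq> complement B x"
proof -
  have c: "complement B y \<in> carrier B"
    using assms by (simp add: complement_closed)
  have "y \<otimes> complement B y \<preceq> \<ff>"
    using assms c residuation[of y "complement B y" \<ff>]
    by (simp add: complement_def leq_refl falsum_closed)
  moreover have "x \<otimes> complement B y \<preceq> y \<otimes> complement B y"
    using assms c by (simp add: mult_isotone leq_refl)
  ultimately have "x \<otimes> complement B y \<preceq> \<ff>"
    using assms c leq_trans[of "x \<otimes> complement B y" "y \<otimes> complement B y" \<ff>] falsum_closed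
    by simp
  then show ?thesis
    using assms c residuation[of x "complement B y" \<ff>] by (simp add: complement_def falsum_closed)
qed

lemma complement_one: "complement B \<one> = \<ff>"
proof (rule leq_antisym)
  have "\<one> \<otimes> \<ff> \<preceq> \<ff>"
    by (simp add: falsum_closed leq_refl)
  then show "\<ff> \<preceq> complement B \<one>"
    using residuation[of \<one> \<ff> \<ff>] by (simp add: complement_def falsum_closed)
  have "\<one> \<otimes> complement B \<one> \<preceq> \<ff>"
    using residuation[of \<one> "complement B \<one>" \<ff>] complement_closed[OF one_closed]
    by (simp add: complement_def falsum_closed leq_refl)
  then show "complement B \<one> \<preceq> \<ff>"
    by (simp add: complement_closed)
qed (simp_all add: complement_closed falsum_closed)

text \<open>De Morgan duality: sums are complements of products of complements, and the inner double
  complements cancel by involution. The empty sum is the case of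
  \<open>complement_one\<close>.\<close>

lemma sum_pow_bimonoid_reduct:
  assumes "x \<in> carrier B"
  shows "x [^]\<^bsub>sum_pomonoid (bimonoid_reduct B)\<^esub> (n::nat) = complement B (complement B x [^] n)"
proof (induction n)
  case 0
  then show ?case
    by (simp add: nat_pow_def sum_pomonoid_def bimonoid_reduct_def complement_one)
next
  case (Suc n)
  then show ?case
    using assms complement_closed[OF assms]
    by (simp add: nat_pow_def sum_pomonoid_def bimonoid_reduct_def complement_complement
        flip: nat_pow_def)
qed

text \<open>The inequality \<open>nx \<le> x\<close> is \<open>z \<le> z^n\<close> for the
  complement \<open>z\<close> of \<open>x\<close>, reversed by complementation.\<close>

lemma sum_contractive_bimonoid_reduct:
  assumes "mult_expansive N B"
  shows "sum_contractive N (bimonoid_reduct B)"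
  unfolding sum_contractive_def
proof (intro ballI)
  fix n x assume n: "n \<in> N" and "x \<in> carrier (bimonoid_reduct B)"
  then have x: "x \<in> carrier B"
    by (simp add: bimonoid_reduct_def)
  have "complement B x \<preceq> complement B x [^] n"
    using assms n x by (simp add: mult_expansive_def complement_closed)
  then have "complement B (complement B x [^] n) \<preceq> complement B (complement B x)"
    using x by (intro complement_antitone) (simp_all add: complement_closed)
  then show "x [^]\<^bsub>sum_pomonoid (bimonoid_reduct B)\<^esub> n \<preceq>\<^bsub>bimonoid_reduct B\<^esub> x"
    using x by (simp add: sum_pow_bimonoid_reduct complement_complement)
      (simp add: bimonoid_reduct_def)
qed

end

lemma mult_expansive_bimonoid_reduct:
  "mult_expansive N (bimonoid_reduct B) \<longleftrightarrow> mult_expansive N B"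
  by (simp add: mult_expansive_def bimonoid_reduct_def nat_pow_def)

section \<open>Transfer along embeddings\<close>

lemma bimonoid_embedding_pow:
  assumes "comm_bimonoid A" "bimonoid_embedding A C h" "x \<in> carrier A"
  shows "h (x [^]\<^bsub>A\<^esub> (n::nat)) = h x [^]\<^bsub>C\<^esub> n"
proof -
  interpret comm_bimonoid A by fact
  show ?thesis
  proof (induction n)
    case 0
    then show ?case
      using assms(2) by (simp add: nat_pow_def bimonoid_embedding_def)
  next
    case (Suc n)
    then show ?case
      using assms(2,3) by (simp add: bimonoid_embedding_def)
  qed
qed

lemma bimonoid_embedding_sum_pow:
  assumes "comm_bimonoid A" "bimonoid_embedding A C h" "x \<in> carrier A"
  shows "h (x [^]\<^bsub>sum_pomonoid A\<^esub> (n::nat)) = h x [^]\<^bsub>sum_pomonoid C\<^esub> n"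
proof -
  interpret comm_bimonoid A by fact
  have closed: "x [^]\<^bsub>sum_pomonoid A\<^esub> k \<in> carrier A" for k :: nat
    using sum.nat_pow_closed[of x k] assms(3) by (simp add: sum_pomonoid_def)
  show ?thesis
  proof (induction n)
    case 0
    then show ?case
      using assms(2) by (simp add: nat_pow_def bimonoid_embedding_def sum_pomonoid_def)
  next
    case (Suc n)
    have "h (x [^]\<^bsub>sum_pomonoid A\<^esub> Suc n) = h (x [^]\<^bsub>sum_pomonoid A\<^esub> n \<oplus>\<^bsub>A\<^esub> x)"
      by (simp add: sum_pomonoid_def nat_pow_def)
    also have "\<dots> = h (x [^]\<^bsub>sum_pomonoid A\<^esub> n) \<oplus>\<^bsub>C\<^esub> h x"
      using assms(2,3) closed by (simp add: bimonoid_embedding_def)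
    also have "\<dots> = h x [^]\<^bsub>sum_pomonoid C\<^esub> Suc n"
      unfolding Suc by (simp add: sum_pomonoid_def nat_pow_def)
    finally show ?case .
  qed
qed

text \<open>Embeddings commute with powers and reflect the order, so the inequality passes down from
  \<open>C\<close> to \<open>A\<close>.\<close>

lemma mult_expansive_embedding:
  assumes "comm_bimonoid A" "bimonoid_embedding A C h" "mult_expansive N C"
  shows "mult_expansive N A"
  unfolding mult_expansive_def
proof (intro ballI)
  interpret comm_bimonoid A by fact
  fix n x assume n: "n \<in> N" and x: "x \<in> carrier A"
  have "h x \<in> carrier C"
    using assms(2) x by (auto simp: bimonoid_embedding_def)
  then have "h x \<preceq>\<^bsub>C\<^esub> h (x [^]\<^bsub>A\<^esub> n)"
    using assms(3) n bimonoid_embedding_pow[OF assms(1,2) x] by (simp add: mult_expansive_def)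
  then show "x \<preceq>\<^bsub>A\<^esub> x [^]\<^bsub>A\<^esub> n"
    using assms(2) x by (simp add: bimonoid_embedding_def)
qed

lemma sum_contractive_embedding:
  assumes "comm_bimonoid A" "bimonoid_embedding A C h" "sum_contractive N C"
  shows "sum_contractive N A"
  unfolding sum_contractive_def
proof (intro ballI)
  interpret comm_bimonoid A by fact
  fix n x assume n: "n \<in> N" and x: "x \<in> carrier A"
  have closed: "x [^]\<^bsub>sum_pomonoid A\<^esub> n \<in> carrier A"
    using sum.nat_pow_closed[of x n] x by (simp add: sum_pomonoid_def)
  have "h x \<in> carrier C"
    using assms(2) x by (auto simp: bimonoid_embedding_def)
  then have "h (x [^]\<^bsub>sum_pomonoid A\<^esub> n) \<preceq>\<^bsub>C\<^esub> h x"
    using assms(3) n bimonoid_embedding_sum_pow[OF assms(1,2) x] by (simp add: sum_contractive_def)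
  then show "x [^]\<^bsub>sum_pomonoid A\<^esub> n \<preceq>\<^bsub>A\<^esub> x"
    using assms(2) x closed by (simp add: bimonoid_embedding_def)
qed

lemma subreduct_class_subset: "subreduct_class T N \<subseteq> axiomatized_class N"
proof
  fix A :: "'a bimonoid" assume "A \<in> subreduct_class T N"
  then obtain B :: "'b irpomonoid" and h where B: "comm_inv_res_pomonoid B" "mult_expansive N B"
    and A: "comm_bimonoid A" and h: "bimonoid_embedding A (bimonoid_reduct B) h"
    by (auto simp: subreduct_class_def bimonoidal_subreduct_def)
  have "mult_expansive N A"
    using mult_expansive_embedding[OF A h] B(2) by (simp add: mult_expansive_bimonoid_reduct)
  moreover have "sum_contractive N A"
    using sum_contractive_embedding[OF A h]
      comm_inv_res_pomonoid.sum_contractive_bimonoid_reduct[OF B] .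
  ultimately show "A \<in> axiomatized_class N"
    using A by (simp add: axiomatized_class_def)
qed

section \<open>Phase spaces\<close>

locale phase_space = comm_monoid M for M :: "('a, 'm) monoid_scheme" (structure) +
  fixes D :: "'a set"
begin

text \<open>The orthogonal with respect to the pole \<open>D\<close>. By commutativity it forms an
  antitone Galois connection with itself, so applying it twice is a closure operator on subsets of
  the carrier.\<close>

definition polar :: "'a set \<Rightarrow> 'a set" where
  "polar X = {y \<in> carrier M. \<forall>x\<in>X. x \<otimes> y \<in> D}"

text \<open>The closed sets under inclusion. Here \<open>falsum\<close> is the part of
  \<open>D\<close> inside the carrier, and \<open>resid\<close> is linear implication, written as
  the orthogonal of \<open>X\<close> times the orthogonal of \<open>Y\<close>.\<close>

definition facts :: "'a set irpomonoid" where
  "facts = \<lparr>carrier = {X. X \<subseteq> carrier M \<and> polar (polar X) = X},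
     monoid.mult = (\<lambda>X Y. polar (polar (X <#> Y))), one = polar (polar {\<one>}), leq = (\<subseteq>),
     resid = (\<lambda>X Y. polar (X <#> polar Y)), falsum = polar {\<one>}\<rparr>"

section \<open>The Galois connection of orthogonals and its interplay with products\<close>

lemma polar_subset: "polar X \<subseteq> carrier M"
  by (auto simp: polar_def)

lemma polar_antimono: "X \<subseteq> Y \<Longrightarrow> polar Y \<subseteq> polar X"
  by (auto simp: polar_def)

lemma subset_polar_iff:
  assumes "X \<subseteq> carrier M" "Y \<subseteq> carrier M"
  shows "X \<subseteq> polar Y \<longleftrightarrow> Y \<subseteq> polar X"
  using assms unfolding polar_def by (simp add: subset_iff) (metis m_comm)

lemma subset_polar_polar: "X \<subseteq> carrier M \<Longrightarrow> X \<subseteq> polar (polar X)"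
  using subset_polar_iff[of X "polar X"] by (simp add: polar_subset)

lemma polar_polar_polar: "X \<subseteq> carrier M \<Longrightarrow> polar (polar (polar X)) = polar X"
  by (intro equalityI polar_antimono subset_polar_polar polar_subset)

lemma set_mult_subset: "X \<subseteq> carrier M \<Longrightarrow> Y \<subseteq> carrier M \<Longrightarrow> X <#> Y \<subseteq> carrier M"
  by (auto simp: set_mult_def)

lemma set_mult_comm:
  assumes "X \<subseteq> carrier M" "Y \<subseteq> carrier M"
  shows "X <#> Y = Y <#> X"
proof -
  have "x \<otimes> y = y \<otimes> x" if "x \<in> X" "y \<in> Y" for x y
    using that assms by (intro m_comm) auto
  then show ?thesis
    by (auto simp: set_mult_def) metis
qed

lemma set_mult_assoc':
  assumes "X \<subseteq> carrier M" "Y \<subseteq> carrier M" "Z \<subseteq> carrier M"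
  shows "(X <#> Y) <#> Z = X <#> (Y <#> Z)"
proof -
  have "(x \<otimes> y) \<otimes> z = x \<otimes> (y \<otimes> z)" if "x \<in> X" "y \<in> Y" "z \<in> Z" for x y z
    using that assms by (intro m_assoc) auto
  then show ?thesis
    unfolding set_mult_def by auto
qed

lemma set_mult_one: "X \<subseteq> carrier M \<Longrightarrow> {\<one>} <#> X = X"
  by (auto simp: set_mult_def subset_iff)

text \<open>Both sides say that all products of elements of \<open>X\<close>, \<open>Y\<close> and
  \<open>Z\<close> lie in \<open>D\<close>. This transposition of a factor yields the closure laws
  for products as well as residuation.\<close>

lemma subset_polar_set_mult_iff:
  assumes "X \<subseteq> carrier M" "Y \<subseteq> carrier M" "Z \<subseteq> carrier M"
  shows "X \<subseteq> polar (Y <#> Z) \<longleftrightarrow> X <#> Y \<subseteq> polar Z"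
proof -
  have "(y \<otimes> z) \<otimes> x = z \<otimes> (x \<otimes> y)" if "x \<in> X" "y \<in> Y" "z \<in> Z" for x y z
  proof -
    have "x \<in> carrier M" "y \<in> carrier M" "z \<in> carrier M"
      using that assms by auto
    then show ?thesis
      by (simp add: m_ac)
  qed
  then have "(\<forall>x\<in>X. \<forall>y\<in>Y. \<forall>z\<in>Z. (y \<otimes> z) \<otimes> x \<in> D) \<longleftrightarrow> (\<forall>x\<in>X. \<forall>y\<in>Y. \<forall>z\<in>Z. z \<otimes> (x \<otimes> y) \<in> D)"
    by simp
  moreover have "X \<subseteq> polar (Y <#> Z) \<longleftrightarrow> (\<forall>x\<in>X. \<forall>y\<in>Y. \<forall>z\<in>Z. (y \<otimes> z) \<otimes> x \<in> D)"
    using assms(1) by (auto simp: polar_def set_mult_def)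
  moreover have "X <#> Y \<subseteq> polar Z \<longleftrightarrow> (\<forall>x\<in>X. \<forall>y\<in>Y. \<forall>z\<in>Z. z \<otimes> (x \<otimes> y) \<in> D)"
    using set_mult_subset[OF assms(1,2)] by (auto simp: polar_def set_mult_def)
  ultimately show ?thesis
    by simp
qed

text \<open>Once \<open>X\<close> is transposed, \<open>Y\<close> occurs only as
  \<open>polar Y\<close>, which does not change when \<open>Y\<close> is closed.\<close>

lemma polar_set_mult_closure_right:
  assumes "X \<subseteq> carrier M" "Y \<subseteq> carrier M"
  shows "polar (X <#> polar (polar Y)) = polar (X <#> Y)"
proof
  show "polar (X <#> polar (polar Y)) \<subseteq> polar (X <#> Y)"
    using subset_polar_polar[OF assms(2)] by (intro polar_antimono mono_set_mult) auto
  \<comment> \<open>The inclusion of \<open>polar (X <#> Y)\<close> in itself, with \<open>X\<close>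
    transposed.\<close>
  have "polar (X <#> Y) <#> X \<subseteq> polar Y"
    using assms by (simp flip: subset_polar_set_mult_iff add: polar_subset)
  then show "polar (X <#> Y) \<subseteq> polar (X <#> polar (polar Y))"
    using assms by (simp add: subset_polar_set_mult_iff polar_subset polar_polar_polar)
qed

lemma polar_set_mult_closure_left:
  assumes "X \<subseteq> carrier M" "Y \<subseteq> carrier M"
  shows "polar (polar (polar X) <#> Y) = polar (X <#> Y)"
  using polar_set_mult_closure_right[OF assms(2,1)] assms
  by (simp add: set_mult_comm polar_subset)

lemma polar_set_mult_closure:
  assumes "X \<subseteq> carrier M" "Y \<subseteq> carrier M"
  shows "polar (polar (polar X) <#> polar (polar Y)) = polar (X <#> Y)"
  using assms
  by (simp add: polar_set_mult_closure_left polar_set_mult_closure_right polar_subset)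

section \<open>The involutive residuated pomonoid of closed sets\<close>

lemma polar_in_facts: "X \<subseteq> carrier M \<Longrightarrow> polar X \<in> carrier facts"
  by (simp add: facts_def polar_polar_polar polar_subset)

text \<open>The orthogonal of \<open>falsum\<close> is the closure of the unit, which is absorbed by
  the product under \<open>polar\<close>.\<close>

lemma complement_facts: "X \<in> carrier facts \<Longrightarrow> complement facts X = polar X"
  by (simp add: complement_def facts_def polar_set_mult_closure_right set_mult_comm[of X]
      set_mult_one)

text \<open>Under an outer \<open>polar\<close> the inner closures drop out, so the laws reduce to
  those of the set product.\<close>

lemma facts_comm_monoid: "comm_monoid facts"
proof (rule comm_monoidI)
  fix X Y Z assume "X \<in> carrier facts" "Y \<in> carrier facts" "Z \<in> carrier facts"
  then have "X \<subseteq> carrier M" "Y \<subseteq> carrier M" "Z \<subseteq> carrier M"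
    by (simp_all add: facts_def)
  then show "X \<otimes>\<^bsub>facts\<^esub> Y \<otimes>\<^bsub>facts\<^esub> Z = X \<otimes>\<^bsub>facts\<^esub> (Y \<otimes>\<^bsub>facts\<^esub> Z)"
    by (simp add: facts_def polar_set_mult_closure_left polar_set_mult_closure_right
        set_mult_subset set_mult_assoc')
next
  fix X Y assume "X \<in> carrier facts" "Y \<in> carrier facts"
  then have XY: "X \<subseteq> carrier M" "Y \<subseteq> carrier M"
    by (simp_all add: facts_def)
  then show "X \<otimes>\<^bsub>facts\<^esub> Y = Y \<otimes>\<^bsub>facts\<^esub> X"
    by (simp add: facts_def set_mult_comm)
  show "X \<otimes>\<^bsub>facts\<^esub> Y \<in> carrier facts"
    using polar_in_facts[OF polar_subset] by (simp add: facts_def)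
next
  show "\<one>\<^bsub>facts\<^esub> \<in> carrier facts"
    using polar_in_facts[OF polar_subset] by (simp add: facts_def)
  fix X assume "X \<in> carrier facts"
  then show "\<one>\<^bsub>facts\<^esub> \<otimes>\<^bsub>facts\<^esub> X = X"
    by (simp add: facts_def polar_set_mult_closure_left set_mult_one)
qed

lemma facts_comm_inv_res_pomonoid: "comm_inv_res_pomonoid facts"
proof -
  interpret F: comm_monoid facts
    by (rule facts_comm_monoid)
  show ?thesis
  proof unfold_locales
    fix X Y U V
    assume "X \<preceq>\<^bsub>facts\<^esub> Y" "U \<preceq>\<^bsub>facts\<^esub> V"
    then show "X \<otimes>\<^bsub>facts\<^esub> U \<preceq>\<^bsub>facts\<^esub> Y \<otimes>\<^bsub>facts\<^esub> V"
      by (simp add: facts_def polar_antimono mono_set_mult)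
  next
    fix X Y Z assume "X \<in> carrier facts" "Y \<in> carrier facts" "Z \<in> carrier facts"
    then have X: "X \<subseteq> carrier M" and Y: "Y \<subseteq> carrier M" and Z: "Z \<subseteq> carrier M"
      and ZZ: "polar (polar Z) = Z"
      by (simp_all add: facts_def)
    \<comment> \<open>As \<open>Z\<close> is closed, it contains the product exactly when it
      contains its closure. Writing \<open>Z\<close> as a double orthogonal prepares the
      transposition of \<open>X\<close>.\<close>
    have "polar (polar (X <#> Y)) \<subseteq> Z \<longleftrightarrow> Y <#> X \<subseteq> polar (polar Z)"
      using polar_antimono[OF polar_antimono, of "X <#> Y" Z]
        subset_polar_polar[OF set_mult_subset[OF X Y]]
      by (auto simp: ZZ set_mult_comm[OF X Y])
    then show "X \<otimes>\<^bsub>facts\<^esub> Y \<preceq>\<^bsub>facts\<^esub> Z \<longleftrightarrow> Y \<preceq>\<^bsub>facts\<^esub> X \<leadsto>\<^bsub>facts\<^esub> Z"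
      using subset_polar_set_mult_iff[OF Y X polar_subset] by (simp add: facts_def)
  next
    fix X Y assume "X \<in> carrier facts" "Y \<in> carrier facts"
    then show "X \<leadsto>\<^bsub>facts\<^esub> Y \<in> carrier facts"
      using polar_in_facts[of "X <#> polar Y"] by (simp add: facts_def set_mult_subset polar_subset)
  next
    show "\<ff>\<^bsub>facts\<^esub> \<in> carrier facts"
      using polar_in_facts[of "{\<one>}"] by (simp add: facts_def)
  next
    fix X assume X: "X \<in> carrier facts"
    then have "X \<subseteq> carrier M"
      by (simp add: facts_def)
    then have "complement facts (complement facts X) = polar (polar X)"
      using X by (simp add: complement_facts polar_in_facts)
    then show "(X \<leadsto>\<^bsub>facts\<^esub> \<ff>\<^bsub>facts\<^esub>) \<leadsto>\<^bsub>facts\<^esub> \<ff>\<^bsub>facts\<^esub> = X"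
      using X by (simp add: complement_def) (simp add: facts_def)
  qed (auto simp: facts_def)
qed

text \<open>A product of closed sets contains the set product that it closes; for exponent 0, the
  unit lies in its own closure.\<close>

lemma pow_mem_facts_pow:
  assumes "X \<in> carrier facts" "x \<in> X"
  shows "x [^] (n::nat) \<in> X [^]\<^bsub>facts\<^esub> n"
proof -
  interpret F: comm_monoid facts
    by (rule facts_comm_monoid)
  show ?thesis
  proof (induction n)
    case 0
    have "\<one> \<in> polar (polar {\<one>})"
      using subset_polar_polar[of "{\<one>}"] by simp
    then show ?case
      by (simp add: nat_pow_def facts_def)
  next
    case (Suc n)
    have "X [^]\<^bsub>facts\<^esub> n \<subseteq> carrier M" "X \<subseteq> carrier M"
      using F.nat_pow_closed[OF assms(1), of n] assms(1) by (simp_all add: facts_def)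
    then have "X [^]\<^bsub>facts\<^esub> n <#> X \<subseteq> X [^]\<^bsub>facts\<^esub> Suc n"
      using subset_polar_polar[OF set_mult_subset] by (simp add: facts_def)
    moreover have "x [^] Suc n \<in> X [^]\<^bsub>facts\<^esub> n <#> X"
      using Suc assms(2) by (auto simp: set_mult_def)
    ultimately show ?case ..
  qed
qed

text \<open>Both \<open>X\<close> and its power are closed, so it suffices that every
  \<open>y\<close> orthogonal to the power is orthogonal to \<open>X\<close>. For this,
  \<open>y\<close> is tested on the elements \<open>x^n\<close> with
  \<open>x \<in> X\<close>.\<close>

lemma mult_expansive_facts:
  assumes "\<And>n x y. \<lbrakk>n \<in> N; x \<in> carrier M; y \<in> carrier M; x [^] n \<otimes> y \<in> D\<rbrakk> \<Longrightarrow> x \<otimes> y \<in> D"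
  shows "mult_expansive N facts"
  unfolding mult_expansive_def
proof (intro ballI)
  interpret F: comm_monoid facts
    by (rule facts_comm_monoid)
  fix n X assume n: "n \<in> N" and X: "X \<in> carrier facts"
  have XM: "X \<subseteq> carrier M"
    using X by (simp add: facts_def)
  have "polar (X [^]\<^bsub>facts\<^esub> n) \<subseteq> polar X"
  proof
    fix y assume "y \<in> polar (X [^]\<^bsub>facts\<^esub> n)"
    then have y: "y \<in> carrier M" "x [^] n \<otimes> y \<in> D" if "x \<in> X" for x
      using pow_mem_facts_pow[OF X that, of n] by (auto simp: polar_def)
    show "y \<in> polar X"
      using \<open>y \<in> polar (X [^]\<^bsub>facts\<^esub> n)\<close> assms[OF n _ _ y(2)] XM by (auto simp: polar_def)
  qed
  then have "polar (polar X) \<subseteq> polar (polar (X [^]\<^bsub>facts\<^esub> n))"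
    by (rule polar_antimono)
  then show "X \<preceq>\<^bsub>facts\<^esub> X [^]\<^bsub>facts\<^esub> n"
    using X F.nat_pow_closed[OF X, of n] by (simp add: facts_def)
qed

end

section \<open>The phase space of a commutative bimonoid\<close>

context comm_bimonoid
begin

lemma sum_closed: "x \<in> carrier A \<Longrightarrow> y \<in> carrier A \<Longrightarrow> x \<oplus> y \<in> carrier A"
  using sum.m_closed by (simp add: sum_pomonoid_def)

lemma zero_closed: "\<zero> \<in> carrier A"
  using sum.one_closed by (simp add: sum_pomonoid_def)

lemma sum_comm: "x \<in> carrier A \<Longrightarrow> y \<in> carrier A \<Longrightarrow> x \<oplus> y = y \<oplus> x"
  using sum.m_comm by (simp add: sum_pomonoid_def)

lemma sum_zero: "x \<in> carrier A \<Longrightarrow> x \<oplus> \<zero> = x" "x \<in> carrier A \<Longrightarrow> \<zero> \<oplus> x = x"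
  using sum.r_one sum.l_one by (simp_all add: sum_pomonoid_def)

lemma sum_assoc:
  "x \<in> carrier A \<Longrightarrow> y \<in> carrier A \<Longrightarrow> z \<in> carrier A \<Longrightarrow> x \<oplus> y \<oplus> z = x \<oplus> (y \<oplus> z)"
  using sum.m_assoc by (simp add: sum_pomonoid_def)

lemma sum_isotone:
  "\<lbrakk>x \<in> carrier A; y \<in> carrier A; u \<in> carrier A; v \<in> carrier A; x \<preceq> y; u \<preceq> v\<rbrakk>
    \<Longrightarrow> x \<oplus> u \<preceq> y \<oplus> v"
  using sum.mult_isotone by (simp add: sum_pomonoid_def)

lemma sum_pow_closed: "x \<in> carrier A \<Longrightarrow> x [^]\<^bsub>sum_pomonoid A\<^esub> (n::nat) \<in> carrier A"
  using sum.nat_pow_closed[of x n] by (simp add: sum_pomonoid_def)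

text \<open>In an involutive residuated pomonoid, \<open>a\<close> times the complement of
  \<open>b\<close> lies below falsum exactly when \<open>a \<preceq> b\<close>.\<close>

definition pole :: "('a \<times> 'a) set" where
  "pole = {(a, b). a \<in> carrier A \<and> b \<in> carrier A \<and> a \<preceq> b}"

lemma mem_pole_iff: "(a, b) \<in> pole \<longleftrightarrow> a \<in> carrier A \<and> b \<in> carrier A \<and> a \<preceq> b"
  by (simp add: pole_def)

lemma pair_monoid_simps:
  "carrier (sum_pomonoid A) = carrier A"
  "\<one>\<^bsub>sum_pomonoid A\<^esub> = \<zero>"
  "monoid.mult (sum_pomonoid A) = bsum A"
  "carrier (A \<times>\<times> sum_pomonoid A) = carrier A \<times> carrier A"
  "(a, b) \<otimes>\<^bsub>A \<times>\<times> sum_pomonoid A\<^esub> (c, d) = (a \<otimes> c, b \<oplus> d)"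
  "\<one>\<^bsub>A \<times>\<times> sum_pomonoid A\<^esub> = (\<one>, \<zero>)"
  by (simp_all add: DirProd_def sum_pomonoid_def)

lemma pair_comm_monoid: "comm_monoid (A \<times>\<times> sum_pomonoid A)"
  by (rule comm_monoidI)
    (auto simp: pair_monoid_simps sum_closed zero_closed sum_zero sum_assoc m_assoc
      intro: m_comm sum_comm)

sublocale pairs: phase_space "A \<times>\<times> sum_pomonoid A" pole
  by (intro phase_space.intro pair_comm_monoid)

lemma pair_pow:
  "(a, b) [^]\<^bsub>A \<times>\<times> sum_pomonoid A\<^esub> (n::nat) = (a [^] n, b [^]\<^bsub>sum_pomonoid A\<^esub> n)"
  by (induction n) (simp_all add: nat_pow_def DirProd_def)

text \<open>The pair \<open>(\<one>, a)\<close> is the formal complement of \<open>a\<close>, so its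
  orthogonal represents \<open>a\<close>. In this form closedness is automatic and membership is a
  single inequality.\<close>

definition principal :: "'a \<Rightarrow> ('a \<times> 'a) set" where
  "principal a = pairs.polar {(\<one>, a)}"

lemma mem_principal_iff:
  "a \<in> carrier A \<Longrightarrow>
    (c, d) \<in> principal a \<longleftrightarrow> c \<in> carrier A \<and> d \<in> carrier A \<and> c \<preceq> a \<oplus> d"
  by (auto simp: principal_def pairs.polar_def pair_monoid_simps mem_pole_iff sum_closed)

text \<open>A cut: from \<open>c \<preceq> a \<oplus> d\<close> and
  \<open>a \<otimes> e \<preceq> f\<close>, hemidistributivity gives
  \<open>c \<otimes> e \<preceq> d \<oplus> f\<close>. So what is orthogonal to
  \<open>(a, \<zero>)\<close> is orthogonal to all of \<open>principal a\<close>.\<close>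

lemma polar_principal:
  assumes a: "a \<in> carrier A"
  shows "pairs.polar (principal a) = pairs.polar {(a, \<zero>)}"
proof
  have "(a, \<zero>) \<in> principal a"
    using a by (simp add: mem_principal_iff sum_zero zero_closed leq_refl)
  then show "pairs.polar (principal a) \<subseteq> pairs.polar {(a, \<zero>)}"
    by (intro pairs.polar_antimono) simp
  show "pairs.polar {(a, \<zero>)} \<subseteq> pairs.polar (principal a)"
  proof clarify
    fix e f assume "(e, f) \<in> pairs.polar {(a, \<zero>)}"
    then have ef: "e \<in> carrier A" "f \<in> carrier A" "a \<otimes> e \<preceq> f"
      by (auto simp: pairs.polar_def pair_monoid_simps mem_pole_iff sum_zero)
    have "c \<otimes> e \<preceq> d \<oplus> f" if cd: "c \<in> carrier A" "d \<in> carrier A" "c \<preceq> a \<oplus> d" for c d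
    proof -
      have "c \<otimes> e \<preceq> (a \<oplus> d) \<otimes> e"
        using a cd ef by (simp add: mult_isotone leq_refl sum_closed)
      moreover have "(a \<oplus> d) \<otimes> e \<preceq> a \<otimes> e \<oplus> d"
        using a cd ef hemidistrib[of e a d] by (simp add: m_comm sum_closed)
      moreover have "a \<otimes> e \<oplus> d \<preceq> d \<oplus> f"
        using a cd ef sum_isotone[of "a \<otimes> e" f d d] by (simp add: leq_refl sum_comm)
      ultimately show ?thesis
        using a cd ef leq_trans[of "c \<otimes> e" "(a \<oplus> d) \<otimes> e" "a \<otimes> e \<oplus> d"]
          leq_trans[of "c \<otimes> e" "a \<otimes> e \<oplus> d" "d \<oplus> f"]
        by (simp add: sum_closed)
    qed
    then show "(e, f) \<in> pairs.polar (principal a)"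
      using a ef
      by (auto simp: pairs.polar_def pair_monoid_simps mem_pole_iff mem_principal_iff sum_closed)
  qed
qed

lemma principal_in_facts: "a \<in> carrier A \<Longrightarrow> principal a \<in> carrier pairs.facts"
  unfolding principal_def by (rule pairs.polar_in_facts) (simp add: pair_monoid_simps)

text \<open>A closed set is its own double orthogonal, and the inner orthogonal is known from the
  cut. This form suits products, the defining one suits sums.\<close>

lemma principal_eq_closure:
  "a \<in> carrier A \<Longrightarrow> principal a = pairs.polar (pairs.polar {(a, \<zero>)})"
  using principal_in_facts[of a] by (simp add: pairs.facts_def flip: polar_principal)

lemma principal_embedding: "bimonoid_embedding A (bimonoid_reduct pairs.facts) principal"
  unfolding bimonoid_embedding_def
proof (intro conjI ballI)
  show "principal \<in> carrier A \<rightarrow> carrier (bimonoid_reduct pairs.facts)"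
    by (simp add: bimonoid_reduct_def principal_in_facts)
  \<comment> \<open>The unit pair is \<open>(\<one>, \<zero>)\<close>:
    \<open>principal \<one>\<close> is its closure and \<open>principal \<zero>\<close> its
    orthogonal.\<close>
  show "principal \<one> = \<one>\<^bsub>bimonoid_reduct pairs.facts\<^esub>"
    by (simp add: principal_eq_closure bimonoid_reduct_def pairs.facts_def pair_monoid_simps)
  show "principal \<zero> = \<zero>\<^bsub>bimonoid_reduct pairs.facts\<^esub>"
    by (simp add: principal_def bimonoid_reduct_def pairs.facts_def pair_monoid_simps)
next
  fix a b assume ab: "a \<in> carrier A" "b \<in> carrier A"
  have "a \<preceq> b" if "principal a \<subseteq> principal b"
  proof -
    \<comment> \<open>The pair \<open>(a, \<zero>)\<close> represents \<open>a\<close> itself and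
      serves as the test element for reflecting the order.\<close>
    have "(a, \<zero>) \<in> principal a"
      using ab by (simp add: mem_principal_iff sum_zero zero_closed leq_refl)
    then have "(a, \<zero>) \<in> principal b"
      using that by blast
    then show ?thesis
      using ab by (simp add: mem_principal_iff sum_zero)
  qed
  moreover have "principal a \<subseteq> principal b" if "a \<preceq> b"
  proof clarify
    fix c d assume "(c, d) \<in> principal a"
    then have cd: "c \<in> carrier A" "d \<in> carrier A" "c \<preceq> a \<oplus> d"
      using ab by (simp_all add: mem_principal_iff)
    have "a \<oplus> d \<preceq> b \<oplus> d"
      using ab cd that by (simp add: sum_isotone leq_refl)
    then show "(c, d) \<in> principal b"
      using ab cd leq_trans[of c "a \<oplus> d" "b \<oplus> d"] by (simp add: mem_principal_iff sum_closed)
  qed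
  ultimately show "a \<preceq> b \<longleftrightarrow> principal a \<preceq>\<^bsub>bimonoid_reduct pairs.facts\<^esub> principal b"
    by (auto simp: bimonoid_reduct_def pairs.facts_def)
  have sub: "{(a, \<zero>)} \<subseteq> carrier (A \<times>\<times> sum_pomonoid A)"
    "{(b, \<zero>)} \<subseteq> carrier (A \<times>\<times> sum_pomonoid A)"
    "{(\<one>, a)} \<subseteq> carrier (A \<times>\<times> sum_pomonoid A)"
    "{(\<one>, b)} \<subseteq> carrier (A \<times>\<times> sum_pomonoid A)"
    using ab by (simp_all add: pair_monoid_simps zero_closed)
  \<comment> \<open>In the closure form, the product reduces to that of the generators, the single
    pair \<open>(a \<otimes> b, \<zero>)\<close>.\<close>
  have "principal a \<otimes>\<^bsub>pairs.facts\<^esub> principal b =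
      pairs.polar (pairs.polar ({(a, \<zero>)} <#>\<^bsub>A \<times>\<times> sum_pomonoid A\<^esub> {(b, \<zero>)}))"
    using ab by (simp add: pairs.facts_def principal_eq_closure
        pairs.polar_set_mult_closure[OF sub(1,2)])
  also have "\<dots> = principal (a \<otimes> b)"
    using ab
    by (simp add: set_mult_def pair_monoid_simps principal_eq_closure sum_zero zero_closed)
  finally show "principal (a \<otimes> b) = principal a \<otimes>\<^bsub>bimonoid_reduct pairs.facts\<^esub> principal b"
    by (simp add: bimonoid_reduct_def)
  interpret F: comm_inv_res_pomonoid pairs.facts
    by (rule pairs.facts_comm_inv_res_pomonoid)
  \<comment> \<open>The orthogonals of \<open>principal a\<close> and \<open>principal b\<close> are
    the closures of \<open>{(\<one>, a)}\<close> and \<open>{(\<one>, b)}\<close>, so the sum is the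
    orthogonal of the single pair \<open>(\<one>, a \<oplus> b)\<close>.\<close>
  have "complement pairs.facts (complement pairs.facts (principal a) \<otimes>\<^bsub>pairs.facts\<^esub>
        complement pairs.facts (principal b)) =
      pairs.polar (pairs.polar (principal a) \<otimes>\<^bsub>pairs.facts\<^esub> pairs.polar (principal b))"
    using ab F.complement_closed[OF principal_in_facts]
    by (simp add: pairs.complement_facts[OF principal_in_facts] pairs.complement_facts)
  also have "\<dots> = pairs.polar ({(\<one>, a)} <#>\<^bsub>A \<times>\<times> sum_pomonoid A\<^esub> {(\<one>, b)})"
    by (simp add: pairs.facts_def principal_def pairs.polar_set_mult_closure[OF sub(3,4)]
        pairs.polar_polar_polar[OF pairs.set_mult_subset[OF sub(3,4)]])
  also have "\<dots> = principal (a \<oplus> b)"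
    by (simp add: set_mult_def pair_monoid_simps principal_def)
  finally show "principal (a \<oplus> b) = principal a \<oplus>\<^bsub>bimonoid_reduct pairs.facts\<^esub> principal b"
    by (simp add: bimonoid_reduct_def)
qed

text \<open>For \<open>p = (a, b)\<close> and \<open>q = (c, d)\<close> the chain is \<open>a
  \<otimes> c \<preceq> a^n \<otimes> c \<preceq> nb \<oplus> d \<preceq> b \<oplus> d\<close>:
  powers in the first coordinate, multiples in the second, the pole in the middle.\<close>

lemma mult_expansive_pair_facts:
  assumes "mult_expansive N A" "sum_contractive N A"
  shows "mult_expansive N pairs.facts"
proof (rule pairs.mult_expansive_facts)
  fix n p q
  assume n: "n \<in> N" and p: "p \<in> carrier (A \<times>\<times> sum_pomonoid A)"
    and q: "q \<in> carrier (A \<times>\<times> sum_pomonoid A)"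
    and le: "p [^]\<^bsub>A \<times>\<times> sum_pomonoid A\<^esub> n \<otimes>\<^bsub>A \<times>\<times> sum_pomonoid A\<^esub> q \<in> pole"
  obtain a b c d where pq: "p = (a, b)" "q = (c, d)"
    by (metis surj_pair)
  then have abcd: "a \<in> carrier A" "b \<in> carrier A" "c \<in> carrier A" "d \<in> carrier A"
    using p q by (simp_all add: pair_monoid_simps)
  have "a \<otimes> c \<preceq> a [^] n \<otimes> c"
    using assms(1) n abcd by (simp add: mult_expansive_def mult_isotone leq_refl)
  moreover have "a [^] n \<otimes> c \<preceq> b [^]\<^bsub>sum_pomonoid A\<^esub> n \<oplus> d"
    using le by (simp add: pq pair_pow pair_monoid_simps mem_pole_iff)
  moreover have "b [^]\<^bsub>sum_pomonoid A\<^esub> n \<oplus> d \<preceq> b \<oplus> d"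
    using assms(2) n abcd by (simp add: sum_contractive_def sum_isotone leq_refl sum_pow_closed)
  ultimately have "a \<otimes> c \<preceq> b \<oplus> d"
    using abcd leq_trans[of "a \<otimes> c" "a [^] n \<otimes> c" "b [^]\<^bsub>sum_pomonoid A\<^esub> n \<oplus> d"]
      leq_trans[of "a \<otimes> c" "b [^]\<^bsub>sum_pomonoid A\<^esub> n \<oplus> d" "b \<oplus> d"]
    by (simp add: sum_closed sum_pow_closed)
  then show "p \<otimes>\<^bsub>A \<times>\<times> sum_pomonoid A\<^esub> q \<in> pole"
    using abcd by (simp add: pq pair_monoid_simps mem_pole_iff sum_closed)
qed

end

text \<open>The ambient pomonoid consists of closed sets of pairs over \<open>A\<close>, which fixes
  the ambient type.\<close>

lemma axiomatized_class_subset: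
  "axiomatized_class N \<subseteq> (subreduct_class TYPE(('a \<times> 'a) set) N :: 'a bimonoid set)"
proof
  fix A :: "'a bimonoid" assume "A \<in> axiomatized_class N"
  then have A: "comm_bimonoid A" and N: "mult_expansive N A" "sum_contractive N A"
    by (simp_all add: axiomatized_class_def)
  interpret comm_bimonoid A by fact
  have "bimonoidal_subreduct A pairs.facts"
    using A principal_embedding by (auto simp: bimonoidal_subreduct_def)
  then show "A \<in> subreduct_class TYPE(('a \<times> 'a) set) N"
    using pairs.facts_comm_inv_res_pomonoid mult_expansive_pair_facts[OF N]
    by (auto simp: subreduct_class_def)
qed

text \<open>Soundness is stated for an arbitrary ambient type \<open>'b\<close>, so no choice of
  type yields further subreducts; the type of sets of pairs already realizes the whole axiomatized
  class.\<close>

theorem mainTheorem19: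
  fixes N :: "nat set"
  assumes "\<forall>n\<in>N. 0 < n"
  shows "(subreduct_class TYPE('b) N :: 'a bimonoid set) \<subseteq> axiomatized_class N \<and>
         (subreduct_class TYPE(('a \<times> 'a) set) N :: 'a bimonoid set) = axiomatized_class N"
  by (intro conjI equalityI subreduct_class_subset axiomatized_class_subset)

end
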